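(* Let $L:\mathbb Z^+\to\mathcal L(\mathcal B^0,\mathcal X)$. Consider the nonhomogeneous system $x(n+1)=L(n)x_n+f(n)$, $n\ge 0$, and the associated homogeneous system $x(n+1)=L(n)x_n$, $n\ge 0$. Each of the following two conditions is sufficient for the homogeneous system to be uniformly stable in $\mathcal B^0$: (i) The nonhomogeneous system is $(\ell^\infty,\ell^\infty)$-stable and there exists $m\in\mathbb Z^-$ such that $\sup_{n\in\mathbb Z^+}\|L(n)P_{[-\infty,m]}\|_{\mathcal B^0\to\mathcal X}<\infty$. (ii) The nonhomogeneous system is $(\ell^1,\ell^\infty)$-stable and there exists $m\in\mathbb Z^-$ such that $\sum_{n=0}^\infty\|L(n)P_{[-\infty,m]}\|_{\mathcal B^0\to\mathcal X}<\infty$.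
   Context: $\mathbb Z^+$ and $\mathbb Z^-$ are the sets of nonnegative and nonpositive integers. $(\mathcal X,|\cdot|)$ is a (real or complex) Banach space. $\mathcal X^{\mathbb Z^-}$ is the vector space of all tuples $\varphi=(\varphi^{[m]})_{m\le 0}$ with $\varphi^{[m]}\in\mathcal X$; its zero vector is $0_{\mathcal B}$. $\mathcal B^0=\{\varphi\in\mathcal X^{\mathbb Z^-}: |\varphi|_{\mathcal B^0}:=\sup_{m\le 0}|\varphi^{[m]}|<\infty\}$. $\mathcal L(\mathcal B^0,\mathcal X)$ is the space of bounded linear operators with operator norm $\|\cdot\|_{\mathcal B^0\to\mathcal X}$. For $1\le p\le\infty$, $\ell^p(\mathcal X)$ is the usual space of $p$-summable (bounded if $p=\infty$) functions $\mathbb Z^+\to\mathcal X$. For $x:\mathbb Z\to\mathcal X$ and $n\in\mathbb Z$, the prehistory $x_n\in\mathcal X^{\mathbb Z^-}$ is defined by $x_n^{[m]}=x(n+m)$, $m\le 0$. For $\tau\in\mathbb Z^+$, $\varphi\in\mathcal B^0$ and $f:\mathbb Z^+\to\mathcal X$, $x(\cdot,\tau,\varphi;f):\mathbb Z\to\mathcal X$ is the unique function $x$ with $x_\tau=\varphi$ and $x(n+1)=L(n)x_n+f(n)$ for all $n\ge\tau$; $x_n(\tau,\varphi;f)$ is its prehistory at $n$. $\mathbf 0$ denotes the zero function $f$. $P_{[-\infty,m]}:\mathcal X^{\mathbb Z^-}\to\mathcal X^{\mathbb Z^-}$ keeps the coordinates with index $\le m$ and replaces all other coordinates by zero. The nonhomogeneous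 system is $(\ell^p,\ell^q)$-stable if $x(\cdot,0,0_{\mathcal B};f)$ (restricted to $\mathbb Z^+$) belongs to $\ell^q(\mathcal X)$ for every $f\in\ell^p(\mathcal X)$. The homogeneous system is uniformly stable in $\mathcal B^0$ if there exists $K\ge1$ such that $|x_n(\tau,\varphi;\mathbf 0)|_{\mathcal B^0}\le K|\varphi|_{\mathcal B^0}$ for all $n\ge\tau\ge0$ and all $\varphi\in\mathcal B^0$. *)

theory Defs
  imports "HOL-Analysis.Analysis"
begin

text \<open>
  Indexing convention: the set of nonpositive integers is represented by \<open>nat\<close> through
  \<open>k \<mapsto> -k\<close>, so a tuple \<open>(\<phi>\<^sup>[\<^sup>m\<^sup>])\<close> with \<open>m \<le> 0\<close> is a function \<open>nat \<Rightarrow> 'a\<close> whose value at \<open>k\<close> is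
  the coordinate with index \<open>m = -k\<close>.

  Since \<open>nat\<close> is discrete, every function on it is continuous; hence the library type of bounded
  continuous functions with the supremum norm is the Banach space of all bounded tuples.

  The state space is a Banach space over the reals.  This includes complex Banach spaces: the
  underlying real space has the same norm, and a bounded complex-linear operator is a bounded
  real-linear operator with the same operator norm.
\<close>

type_synonym 'a hist = "(nat, 'a) bcontfun"

lemma bcontfun_nat_iff: "(f :: nat \<Rightarrow> 'a::metric_space) \<in> bcontfun \<longleftrightarrow> bounded (range f)"
  by (auto simp: bcontfun_def continuous_on_open_vimage)

definition prehist :: "(int \<Rightarrow> 'a) \<Rightarrow> int \<Rightarrow> nat \<Rightarrow> 'a" where
  "prehist x n = (\<lambda>k. x (n - int k))"

text \<open>
  The prehistory as an element of the space of bounded tuples; meaningful only if \<open>prehist x n\<close> is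
  bounded, which holds for all the prehistories used below (\<open>is_solution_prehist_bounded\<close>).
\<close>
definition bprehist :: "(int \<Rightarrow> 'a::metric_space) \<Rightarrow> int \<Rightarrow> 'a hist" where
  "bprehist x n = Bcontfun (prehist x n)"

definition is_solution ::
  "(nat \<Rightarrow> 'a::banach hist \<Rightarrow>\<^sub>L 'a) \<Rightarrow> nat \<Rightarrow> 'a hist \<Rightarrow> (nat \<Rightarrow> 'a) \<Rightarrow> (int \<Rightarrow> 'a) \<Rightarrow> bool" where
  "is_solution L \<tau> \<phi> f x \<longleftrightarrow>
     prehist x (int \<tau>) = apply_bcontfun \<phi> \<and>
     (\<forall>n\<ge>\<tau>. x (int n + 1) = blinfun_apply (L n) (bprehist x (int n)) + f n)"

text \<open>Well defined by \<open>is_solution_ex1\<close> below.\<close>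
definition solution ::
  "(nat \<Rightarrow> 'a::banach hist \<Rightarrow>\<^sub>L 'a) \<Rightarrow> nat \<Rightarrow> 'a hist \<Rightarrow> (nat \<Rightarrow> 'a) \<Rightarrow> int \<Rightarrow> 'a" where
  "solution L \<tau> \<phi> f = (THE x. is_solution L \<tau> \<phi> f x)"

lemma is_solution_prehist_bounded:
  assumes "is_solution L \<tau> \<phi> f x" "\<tau> \<le> n"
  shows "bounded (range (prehist x (int n)))"
  using assms(2)
proof (induction n rule: dec_induct)
  case base
  have "bounded (range (apply_bcontfun \<phi>))"
    using apply_bcontfun[of \<phi>] by (simp add: bcontfun_nat_iff)
  then show ?case using assms(1) by (simp add: is_solution_def)
next
  case (step n)
  have "range (prehist x (int (Suc n))) \<subseteq> insert (x (int (Suc n))) (range (prehist x (int n)))"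
  proof (rule image_subsetI)
    fix k
    show "prehist x (int (Suc n)) k \<in> insert (x (int (Suc n))) (range (prehist x (int n)))"
    proof (cases k)
      case (Suc l)
      then have "prehist x (int (Suc n)) k = prehist x (int n) l" by (simp add: prehist_def)
      then show ?thesis by blast
    qed (simp add: prehist_def)
  qed
  moreover have "bounded (insert (x (int (Suc n))) (range (prehist x (int n))))"
    using step.IH by simp
  ultimately show ?case by (rule bounded_subset[rotated])
qed

lemma is_solution_ex1: "\<exists>!x. is_solution L \<tau> \<phi> f x"
proof (rule ex_ex1I)
  define s where "s = rec_nat (\<lambda>i. apply_bcontfun \<phi> (nat (int \<tau> - i)))
    (\<lambda>j y. y(int \<tau> + int j + 1 :=
       blinfun_apply (L (\<tau> + j)) (bprehist y (int \<tau> + int j)) + f (\<tau> + j)))"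
  have s0: "s 0 = (\<lambda>i. apply_bcontfun \<phi> (nat (int \<tau> - i)))"
    and sS: "s (Suc j) = (s j)(int \<tau> + int j + 1 :=
       blinfun_apply (L (\<tau> + j)) (bprehist (s j) (int \<tau> + int j)) + f (\<tau> + j))" for j
    by (simp_all add: s_def)
  define x where "x = (\<lambda>i. s (nat (i - int \<tau>)) i)"
  have mono: "s k i = s j i" if "j \<le> k" "i \<le> int \<tau> + int j" for j k i
    using that(1)
    by (induction k rule: dec_induct) (use that(2) in \<open>auto simp: sS\<close>)
  have x_eq: "x i = s j i" if "i \<le> int \<tau> + int j" for i j
    unfolding x_def by (rule mono[symmetric]) (use that in auto)
  have pre: "bprehist x (int \<tau> + int j) = bprehist (s j) (int \<tau> + int j)" for j
    unfolding bprehist_def prehist_def by (simp add: x_eq[where j = j])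
  have "x (int n + 1) = blinfun_apply (L n) (bprehist x (int n)) + f n" if "\<tau> \<le> n" for n
  proof -
    obtain j where n: "n = \<tau> + j" using le_Suc_ex[OF \<open>\<tau> \<le> n\<close>] by blast
    have "x (int \<tau> + int j + 1) = s (Suc j) (int \<tau> + int j + 1)" by (rule x_eq) simp
    also have "\<dots> = blinfun_apply (L (\<tau> + j)) (bprehist x (int \<tau> + int j)) + f (\<tau> + j)"
      unfolding sS pre by simp
    finally show ?thesis unfolding n of_nat_add .
  qed
  moreover have "prehist x (int \<tau>) = apply_bcontfun \<phi>"
  proof
    fix k
    have "x (int \<tau> - int k) = s 0 (int \<tau> - int k)" by (rule x_eq) simp
    then show "prehist x (int \<tau>) k = apply_bcontfun \<phi> k" by (simp add: prehist_def s0)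
  qed
  ultimately show "\<exists>x. is_solution L \<tau> \<phi> f x" unfolding is_solution_def by blast
next
  fix x y assume x: "is_solution L \<tau> \<phi> f x" and y: "is_solution L \<tau> \<phi> f y"
  have eq: "prehist x (int n) = prehist y (int n)" if "\<tau> \<le> n" for n
    using that
  proof (induction n rule: dec_induct)
    case base
    show ?case using x y unfolding is_solution_def by metis
  next
    case (step n)
    have new: "x (int n + 1) = y (int n + 1)"
      using x y \<open>\<tau> \<le> n\<close> step.IH by (simp add: is_solution_def bprehist_def)
    show ?case
    proof
      fix k
      show "prehist x (int (Suc n)) k = prehist y (int (Suc n)) k"
      proof (cases k)
        case 0
        then show ?thesis using new by (simp add: prehist_def add.commute)
      next
        case (Suc l)
        then show ?thesis using fun_cong[OF step.IH, of l] by (simp add: prehist_def)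
      qed
    qed
  qed
  show "x = y"
  proof
    fix i
    define n where "n = max \<tau> (nat i)"
    have n: "\<tau> \<le> n" "i \<le> int n" by (auto simp: n_def)
    then have i: "int n - int (nat (int n - i)) = i" by simp
    show "x i = y i"
      using fun_cong[OF eq[OF n(1)], of "nat (int n - i)"] unfolding prehist_def i .
  qed
qed

text \<open>The projection keeping the coordinates with index \<open>-k \<le> m\<close> and annihilating the others,
  restricted to bounded tuples.\<close>
definition past_proj_fun :: "int \<Rightarrow> 'a::real_normed_vector hist \<Rightarrow> 'a hist" where
  "past_proj_fun m \<phi> = Bcontfun (\<lambda>k. if - int k \<le> m then apply_bcontfun \<phi> k else 0)"

lemma apply_past_proj_fun:
  "apply_bcontfun (past_proj_fun m \<phi>) k = (if - int k \<le> m then apply_bcontfun \<phi> k else 0)"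
proof -
  have "bounded (insert 0 (range (apply_bcontfun \<phi>)))"
    using apply_bcontfun[of \<phi>] by (simp add: bcontfun_nat_iff)
  then have "(\<lambda>k. if - int k \<le> m then apply_bcontfun \<phi> k else 0) \<in> bcontfun"
    unfolding bcontfun_nat_iff by (rule bounded_subset) auto
  then show ?thesis by (simp add: past_proj_fun_def Bcontfun_inverse)
qed

lift_definition past_proj :: "int \<Rightarrow> 'a::real_normed_vector hist \<Rightarrow>\<^sub>L 'a hist"
  is past_proj_fun
proof (rule bounded_linear_intro[where K = 1])
  fix m and \<phi> \<psi> :: "'a hist" and r
  show "past_proj_fun m (\<phi> + \<psi>) = past_proj_fun m \<phi> + past_proj_fun m \<psi>"
    by (rule bcontfun_eqI) (simp add: apply_past_proj_fun)
  show "past_proj_fun m (r *\<^sub>R \<phi>) = r *\<^sub>R past_proj_fun m \<phi>"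
    by (rule bcontfun_eqI) (simp add: apply_past_proj_fun)
  show "norm (past_proj_fun m \<phi>) \<le> norm \<phi> * 1"
    by (rule norm_bound) (auto simp: apply_past_proj_fun norm_bounded)
qed

text \<open>Only used for \<open>1 \<le> p\<close>.\<close>
definition ell :: "ennreal \<Rightarrow> (nat \<Rightarrow> 'a::real_normed_vector) set" where
  "ell p = (if p = \<infinity> then {f. bounded (range f)}
            else {f. summable (\<lambda>n. norm (f n) powr enn2real p)})"

definition ell_stable :: "ennreal \<Rightarrow> ennreal \<Rightarrow> (nat \<Rightarrow> 'a::banach hist \<Rightarrow>\<^sub>L 'a) \<Rightarrow> bool" where
  "ell_stable p q L \<longleftrightarrow> (\<forall>f\<in>ell p. (\<lambda>n. solution L 0 0 f (int n)) \<in> ell q)"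

definition uniformly_stable :: "(nat \<Rightarrow> 'a::banach hist \<Rightarrow>\<^sub>L 'a) \<Rightarrow> bool" where
  "uniformly_stable L \<longleftrightarrow>
     (\<exists>K\<ge>1. \<forall>\<tau> n \<phi>. \<tau> \<le> n \<longrightarrow>
        norm (bprehist (solution L \<tau> \<phi> (\<lambda>_. 0)) (int n)) \<le> K * norm \<phi>)"

end

theory Submission
  imports Defs
begin

text \<open>
  Let \<open>x\<close> solve the homogeneous system from time \<open>\<tau>\<close> with prehistory \<open>\<phi>\<close>.  Cutting \<open>x\<close> to zero up to
  time \<open>\<tau>\<close> gives a solution with zero initial data of the nonhomogeneous system whose input at time
  \<open>n \<ge> \<tau>\<close> is \<open>L(n)\<close> applied to the shift of \<open>\<phi>\<close> by \<open>n - \<tau>\<close>.  Once \<open>n - \<tau> \<ge> -m\<close>, only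
  \<open>L(n) P\<^bsub>[-\<infinity>,m]\<^esub>\<close> enters, and the remaining inputs are controlled if \<open>sup\<^sub>n \<parallel>L(n)\<parallel> < \<infinity>\<close>.  The latter
  follows from the stability of the nonhomogeneous system: by the uniform boundedness principle the
  responses to impulses are uniformly bounded, and \<open>L(n)\<close> on finitely many recent coordinates is
  recovered recursively from impulse responses.

  For inputs in \<open>\<ell>\<^sup>1\<close> the principle is applied to the inputs \<open>w g\<close> with \<open>w\<close> a fixed summable weight and
  \<open>g\<close> bounded, so that only the Banach space of bounded sequences is needed; the bounds for all \<open>w\<close>
  together yield a bound on the impulse responses.
\<close>

section \<open>Completeness and boundedness principles\<close>

text \<open>The library has this instance only for metric domains, and \<open>nat\<close> is not declared to be one.\<close>

instance bcontfun :: (topological_space, complete_space) complete_space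
proof
  fix f :: "nat \<Rightarrow> ('a, 'b) bcontfun"
  assume "Cauchy f"
  then have "uniformly_Cauchy_on UNIV (\<lambda>n. apply_bcontfun (f n))"
    unfolding Cauchy_def uniformly_Cauchy_on_def by (meson dist_fun_lt_imp_dist_val_lt)
  then obtain g where "uniform_limit UNIV (\<lambda>n. apply_bcontfun (f n)) g sequentially"
    using Cauchy_uniformly_convergent uniformly_convergent_on_def by blast
  then obtain l where "f \<longlonglongrightarrow> l" by (rule uniform_limit_bcontfunE) simp
  then show "convergent f" by (rule convergentI)
qed

instance bcontfun :: (topological_space, banach) banach ..

text \<open>Banach-Steinhaus by Baire category: the closed sets \<open>A k\<close> cover the space,
  so one of them contains a ball, and linearity carries the bound on that ball over to the
  origin.\<close>

lemma uniform_boundedness: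
  fixes T :: "'i \<Rightarrow> 'b::banach \<Rightarrow> 'c::real_normed_vector"
  assumes lin: "\<And>i. bounded_linear (T i)"
    and bdd: "\<And>x. bounded (range (\<lambda>i. T i x))"
  obtains C where "0 \<le> C" "\<And>i x. norm (T i x) \<le> C * norm x"
proof -
  define A where "A k = {x. \<forall>i. norm (T i x) \<le> real k}" for k
  have closed_A: "closed (A k)" for k
  proof -
    have "closed {x. norm (T i x) \<le> real k}" for i
      by (intro closed_Collect_le continuous_intros linear_continuous_on lin)
    moreover have "A k = (\<Inter>i. {x. norm (T i x) \<le> real k})" by (auto simp: A_def)
    ultimately show ?thesis by auto
  qed
  have "(\<Union>k. A k) = UNIV"
  proof (intro set_eqI iffI UNIV_I)
    fix x
    obtain c where "\<And>i. norm (T i x) \<le> c" using bdd[of x] by (auto simp: bounded_iff)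
    moreover obtain k where "c \<le> real k" using real_arch_simple by blast
    ultimately have "x \<in> A k" unfolding A_def using order_trans by blast
    then show "x \<in> (\<Union>k. A k)" by blast
  qed
  have "\<exists>k. interior (A k) \<noteq> {}"
  proof (rule ccontr)
    assume "\<nexists>k. interior (A k) \<noteq> {}"
    then have "euclidean interior_of \<Union>(range A) = {}"
      by (intro Baire_category_alt) (auto simp: closed_A completely_metrizable_space_euclidean)
    then show False using \<open>(\<Union>k. A k) = UNIV\<close> by simp
  qed
  then obtain k x0 e where "e > 0" and ball: "cball x0 e \<subseteq> A k"
    by (metis ex_in_conv mem_interior_cball)
  have bound: "norm (T i x) \<le> (2 * real k / e) * norm x" for i x
  proof (cases "x = 0")
    case True
    then show ?thesis using linear_0[OF bounded_linear.linear[OF lin]] by simp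
  next
    case False
    \<comment> \<open>Rescaling to norm \<open>e\<close> puts both \<open>x0\<close> and
      \<open>x0 + y\<close> in the ball, so \<open>T i y\<close> is a difference of two vectors of
      norm at most \<open>k\<close>.\<close>
    define y where "y = (e / norm x) *\<^sub>R x"
    have "norm y = e" using False \<open>e > 0\<close> by (simp add: y_def)
    then have "x0 + y \<in> A k" "x0 \<in> A k" using ball \<open>e > 0\<close> by (auto simp: dist_norm)
    then have "norm (T i (x0 + y) - T i x0) \<le> real k + real k"
      by (intro order_trans[OF norm_triangle_ineq4] add_mono) (auto simp: A_def)
    also have "T i (x0 + y) - T i x0 = (e / norm x) *\<^sub>R T i x"
      by (simp add: y_def linear_add[OF bounded_linear.linear[OF lin]]
        linear_scale[OF bounded_linear.linear[OF lin]])
    finally show ?thesis using False \<open>e > 0\<close> by (simp add: field_simps)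
  qed
  show thesis by (rule that[OF _ bound]) (use \<open>e > 0\<close> in simp)
qed

text \<open>If no common constant exists, there are indices \<open>j i\<close> at which the
  constants \<open>4 ^ i\<close> fail. The summable weight with values \<open>(1/2) ^ i\<close>
  there would allow \<open>C * 2 ^ i\<close>, which is eventually smaller than
  \<open>4 ^ i\<close>.\<close>

lemma uniform_bound_if_summable_weights:
  fixes P :: "nat \<Rightarrow> real \<Rightarrow> bool"
  assumes mono: "\<And>k c d. P k c \<Longrightarrow> c \<le> d \<Longrightarrow> P k d"
    and weights: "\<And>w. summable w \<Longrightarrow> (\<And>k. 0 \<le> w k) \<Longrightarrow> \<exists>C. \<forall>k. w k > 0 \<longrightarrow> P k (C / w k)"
  shows "\<exists>C. \<forall>k. P k C"
proof (rule ccontr)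
  assume unb: "\<nexists>C. \<forall>k. P k C"
  have "\<exists>c. P k c" for k
  proof -
    \<comment> \<open>The unit weight at \<open>k\<close> alone yields a constant for this single
      index.\<close>
    have "summable (\<lambda>i. if i = k then 1 else 0 :: real)" by simp
    from weights[OF this] obtain C where "P k (C / 1)" by (metis zero_le_one zero_less_one order_refl)
    then show ?thesis by blast
  qed
  then obtain c where c: "\<And>k. P k (c k)" by metis
  have late: "\<exists>k>J. \<not> P k C" for J C
  proof -
    \<comment> \<open>\<open>D\<close> dominates the constants of the finitely many indices up to
      \<open>J\<close>, so an index at which \<open>D\<close> fails lies beyond
      \<open>J\<close>.\<close>
    define D where "D = Max (insert C (c ` {..J}))"
    obtain k where k: "\<not> P k D" using unb by blast
    have "C \<le> D" and "\<And>i. i \<le> J \<Longrightarrow> c i \<le> D" unfolding D_def by (rule Max_ge; simp)+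
    then show ?thesis using k mono c by (meson not_less)
  qed
  \<comment> \<open>\<open>4 ^ i\<close> is \<open>2 ^ i\<close> squared: one factor will be the
    reciprocal of the weight at \<open>j i\<close>, the other outgrows any \<open>C\<close>.\<close>
  have "\<exists>j. \<forall>i. \<not> P (j i) (4 ^ i) \<and> j i < j (Suc i)"
    by (rule dependent_nat_choice) (use late in blast)+
  then obtain j where j: "\<And>i. \<not> P (j i) (4 ^ i)" and "strict_mono j"
    by (auto simp: strict_mono_Suc_iff)
  define w :: "nat \<Rightarrow> real" where "w k = (if k \<in> range j then (1/2) ^ inv j k else 0)" for k
  have w_j: "w (j i) = (1/2) ^ i" for i
    using strict_mono_imp_inj_on[OF \<open>strict_mono j\<close>] by (simp add: w_def)
  have "summable (\<lambda>i. w (j i))" by (simp add: w_j summable_geometric)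
  then have "summable w"
    by (subst (asm) summable_mono_reindex[OF \<open>strict_mono j\<close>]) (auto simp: w_def)
  moreover have "0 \<le> w k" for k by (simp add: w_def)
  ultimately obtain C where C: "\<And>k. w k > 0 \<Longrightarrow> P k (C / w k)"
    using weights by blast
  obtain i where i: "C < 2 ^ i" using real_arch_pow[of 2 C] by auto
  have "C / w (j i) = C * 2 ^ i" by (simp add: w_j power_divide)
  also have "\<dots> \<le> 2 ^ i * 2 ^ i" using i by (intro mult_right_mono) auto
  also have "\<dots> = 4 ^ i" by (simp flip: power_mult_distrib)
  finally show False using mono[OF C[of "j i"]] j[of i] by (simp add: w_j)
qed

section \<open>Linearity and causality of solutions\<close>

lemma solution_is_solution: "is_solution L \<tau> \<phi> f (solution L \<tau> \<phi> f)"
  unfolding solution_def by (rule theI'[OF is_solution_ex1])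

lemma solution_eqI: "is_solution L \<tau> \<phi> f x \<Longrightarrow> solution L \<tau> \<phi> f = x"
  using is_solution_ex1 solution_is_solution by blast

lemma apply_bprehist:
  assumes "bounded (range (prehist x n))"
  shows "apply_bcontfun (bprehist x n) k = x (n - int k)"
  using assms by (simp add: bprehist_def Bcontfun_inverse bcontfun_nat_iff) (simp add: prehist_def)

lemma apply_bprehist_solution:
  assumes "is_solution L \<tau> \<phi> f x" "\<tau> \<le> n"
  shows "apply_bcontfun (bprehist x (int n)) k = x (int n - int k)"
  by (rule apply_bprehist[OF is_solution_prehist_bounded[OF assms]])

lemma is_solution_past:
  assumes "is_solution L \<tau> \<phi> f x" "i \<le> int \<tau>"
  shows "x i = apply_bcontfun \<phi> (nat (int \<tau> - i))"
proof -
  have "apply_bcontfun \<phi> (nat (int \<tau> - i)) = prehist x (int \<tau>) (nat (int \<tau> - i))"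
    using assms(1) by (simp add: is_solution_def)
  then show ?thesis using assms(2) by (simp add: prehist_def)
qed

lemma is_solution_step:
  assumes "is_solution L \<tau> \<phi> f x" "\<tau> \<le> n"
  shows "x (int (Suc n)) = blinfun_apply (L n) (bprehist x (int n)) + f n"
  using assms by (simp add: is_solution_def add.commute)

lemma norm_bprehist_le:
  assumes "is_solution L \<tau> \<phi> f x" "\<tau> \<le> n" "norm \<phi> \<le> c"
    and "\<And>i. \<tau> < i \<Longrightarrow> i \<le> n \<Longrightarrow> norm (x (int i)) \<le> c"
  shows "norm (bprehist x (int n)) \<le> c"
proof (rule norm_bound)
  fix k
  have "norm (x (int n - int k)) \<le> c"
  proof (cases "int n - int k \<le> int \<tau>")
    case True
    then show ?thesis
      by (simp add: is_solution_past[OF assms(1)] order_trans[OF norm_bounded assms(3)])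
  next
    case False
    then show ?thesis using assms(4)[of "n - k"] by (simp add: of_nat_diff)
  qed
  then show "norm (apply_bcontfun (bprehist x (int n)) k) \<le> c"
    by (simp add: apply_bprehist_solution[OF assms(1,2)])
qed

lemma solution_add:
  "solution L \<tau> (\<phi> + \<psi>) (\<lambda>n. f n + g n) i = solution L \<tau> \<phi> f i + solution L \<tau> \<psi> g i"
proof -
  define x where "x = solution L \<tau> \<phi> f"
  define y where "y = solution L \<tau> \<psi> g"
  have x: "is_solution L \<tau> \<phi> f x" and y: "is_solution L \<tau> \<psi> g y"
    by (simp_all add: x_def y_def solution_is_solution)
  have "bprehist (\<lambda>i. x i + y i) (int n) = bprehist x (int n) + bprehist y (int n)"
    if "\<tau> \<le> n" for n
  proof (rule bcontfun_eqI)
    \<comment> \<open>Once the prehistory is recognized as the coordinates of an element of the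
      space, \<open>Bcontfun\<close> in \<open>bprehist\<close> returns that element; no separate
      boundedness argument is required.\<close>
    have "(\<lambda>k. apply_bcontfun (bprehist x (int n) + bprehist y (int n)) k) =
      prehist (\<lambda>i. x i + y i) (int n)"
      using apply_bprehist_solution[OF x that] apply_bprehist_solution[OF y that]
      by (auto simp: prehist_def)
    then show "apply_bcontfun (bprehist (\<lambda>i. x i + y i) (int n)) k =
      apply_bcontfun (bprehist x (int n) + bprehist y (int n)) k" for k
      by (metis apply_bcontfun_inverse bprehist_def)
  qed
  then have "is_solution L \<tau> (\<phi> + \<psi>) (\<lambda>n. f n + g n) (\<lambda>i. x i + y i)"
    using x y by (auto simp: is_solution_def prehist_def fun_eq_iff blinfun.add_right)
  then show ?thesis by (metis solution_eqI x_def y_def)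
qed

lemma solution_scaleR:
  "solution L \<tau> (c *\<^sub>R \<phi>) (\<lambda>n. c *\<^sub>R f n) i = c *\<^sub>R solution L \<tau> \<phi> f i"
proof -
  define x where "x = solution L \<tau> \<phi> f"
  have x: "is_solution L \<tau> \<phi> f x" by (simp add: x_def solution_is_solution)
  have "bprehist (\<lambda>i. c *\<^sub>R x i) (int n) = c *\<^sub>R bprehist x (int n)" if "\<tau> \<le> n" for n
  proof (rule bcontfun_eqI)
    have "(\<lambda>k. apply_bcontfun (c *\<^sub>R bprehist x (int n)) k) = prehist (\<lambda>i. c *\<^sub>R x i) (int n)"
      using apply_bprehist_solution[OF x that] by (auto simp: prehist_def)
    then show "apply_bcontfun (bprehist (\<lambda>i. c *\<^sub>R x i) (int n)) k =
      apply_bcontfun (c *\<^sub>R bprehist x (int n)) k" for k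
      by (metis apply_bcontfun_inverse bprehist_def)
  qed
  then have "is_solution L \<tau> (c *\<^sub>R \<phi>) (\<lambda>n. c *\<^sub>R f n) (\<lambda>i. c *\<^sub>R x i)"
    using x by (auto simp: is_solution_def prehist_def fun_eq_iff blinfun.scaleR_right algebra_simps)
  then show ?thesis by (metis solution_eqI x_def)
qed

lemma solution_zero_add:
  "solution L \<tau> 0 (\<lambda>n. f n + g n) i = solution L \<tau> 0 f i + solution L \<tau> 0 g i"
  using solution_add[of L \<tau> 0 0] by simp

lemma solution_zero_scaleR: "solution L \<tau> 0 (\<lambda>n. c *\<^sub>R f n) i = c *\<^sub>R solution L \<tau> 0 f i"
  using solution_scaleR[of L \<tau> c 0] by simp

text \<open>At a fixed time the response depends continuously on finitely many inputs;
  \<open>c\<close> may grow with \<open>n\<close>. This gives causality and the continuity of each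
  operator to which uniform boundedness is applied.\<close>

lemma norm_solution_le_sum_input:
  "\<exists>c\<ge>0. \<forall>f. \<forall>i\<le>n. norm (solution L 0 0 f (int i)) \<le> c * (\<Sum>j<n. norm (f j))"
proof (induction n)
  case 0
  have "solution L 0 0 f 0 = 0" for f
    by (subst is_solution_past[OF solution_is_solution]) simp_all
  then show ?case by auto
next
  case (Suc n)
  then obtain c where c: "0 \<le> c"
    "\<And>f i. i \<le> n \<Longrightarrow> norm (solution L 0 0 f (int i)) \<le> c * (\<Sum>j<n. norm (f j))" by blast
  \<comment> \<open>The three summands account for the feedback through \<open>L n\<close>, for the
    bounds at earlier times and for the new input \<open>f n\<close>.\<close>
  define d where "d = norm (L n) * c + c + 1"
  have "norm (solution L 0 0 f (int i)) \<le> d * (\<Sum>j<Suc n. norm (f j))" if "i \<le> Suc n" for f i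
  proof -
    define s where "s = (\<Sum>j<n. norm (f j))"
    have s: "0 \<le> s" by (simp add: s_def sum_nonneg)
    have "d * (s + norm (f n)) = (norm (L n) * (c * s) + norm (f n)) + (c * s + s)
       + (norm (L n) * c + c) * norm (f n)"
      by (simp add: d_def algebra_simps)
    then have d: "norm (L n) * (c * s) + norm (f n) \<le> d * (s + norm (f n))"
      "c * s \<le> d * (s + norm (f n))" using s c(1) by (simp_all add: add_increasing2)
    show ?thesis
    proof (cases "i = Suc n")
      case True
      have pre: "norm (bprehist (solution L 0 0 f) (int n)) \<le> c * s"
        by (rule norm_bprehist_le[OF solution_is_solution]) (use c s in \<open>auto simp: s_def\<close>)
      have "norm (solution L 0 0 f (int i)) \<le>
        norm (blinfun_apply (L n) (bprehist (solution L 0 0 f) (int n))) + norm (f n)"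
        unfolding True is_solution_step[OF solution_is_solution le0] by (rule norm_triangle_ineq)
      also have "\<dots> \<le> norm (L n) * (c * s) + norm (f n)"
        by (intro add_right_mono order_trans[OF norm_blinfun] mult_left_mono pre) simp
      finally show ?thesis using d by (simp add: s_def)
    next
      case False
      then have "norm (solution L 0 0 f (int i)) \<le> c * s" using c(2) that by (simp add: s_def)
      then show ?thesis using d by (simp add: s_def)
    qed
  qed
  moreover have "0 \<le> d" using c(1) by (simp add: d_def)
  ultimately show ?case by blast
qed

text \<open>The difference of the inputs vanishes before time \<open>n\<close>, so the preceding
  estimate makes its response at \<open>n\<close> zero.\<close>

lemma solution_causal:
  assumes "\<And>j. j < n \<Longrightarrow> f j = g j"
  shows "solution L 0 0 f (int n) = solution L 0 0 g (int n)"
proof -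
  obtain c where "norm (solution L 0 0 (\<lambda>j. f j + (-1) *\<^sub>R g j) (int n)) \<le>
    c * (\<Sum>j<n. norm (f j + (-1) *\<^sub>R g j))"
    using norm_solution_le_sum_input by blast
  then show ?thesis
    using assms unfolding solution_zero_add solution_zero_scaleR by simp
qed

section \<open>Uniform response bounds from stability\<close>

text \<open>Uniform boundedness with the time \<open>n\<close> as index. The weight serves both
  stability notions: \<open>w = 1\<close> gives bounded inputs, a summable \<open>w\<close> gives
  absolutely summable ones.\<close>

lemma weighted_input_bound:
  assumes "\<And>g :: 'a::banach hist.
    bounded (range (\<lambda>n. solution L 0 0 (\<lambda>j. w j *\<^sub>R apply_bcontfun g j) (int n)))"
  obtains C where "0 \<le> C" "\<And>g n. norm (solution L 0 0 (\<lambda>j. w j *\<^sub>R apply_bcontfun g j) (int n))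
    \<le> C * norm (g :: 'a hist)"
proof (rule uniform_boundedness[where
      T = "\<lambda>n g. solution L 0 0 (\<lambda>j. w j *\<^sub>R apply_bcontfun (g :: 'a hist) j) (int n)"])
  show "bounded (range (\<lambda>n. solution L 0 0 (\<lambda>j. w j *\<^sub>R apply_bcontfun g j) (int n)))"
    for g :: "'a hist" by (rule assms)
  show "bounded_linear (\<lambda>g :: 'a hist. solution L 0 0 (\<lambda>j. w j *\<^sub>R apply_bcontfun g j) (int n))" for n
  proof -
    obtain c where c: "0 \<le> c"
      "\<And>f. norm (solution L 0 0 f (int n)) \<le> c * (\<Sum>j<n. norm (f j))"
      using norm_solution_le_sum_input by blast
    show ?thesis
    proof (rule bounded_linear_intro[where K = "c * (\<Sum>j<n. \<bar>w j\<bar>)"])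
      fix g h :: "'a hist" and r
      show "solution L 0 0 (\<lambda>j. w j *\<^sub>R apply_bcontfun (g + h) j) (int n) =
        solution L 0 0 (\<lambda>j. w j *\<^sub>R apply_bcontfun g j) (int n) +
        solution L 0 0 (\<lambda>j. w j *\<^sub>R apply_bcontfun h j) (int n)"
        by (simp add: scaleR_add_right flip: solution_zero_add)
      show "solution L 0 0 (\<lambda>j. w j *\<^sub>R apply_bcontfun (r *\<^sub>R g) j) (int n) =
        r *\<^sub>R solution L 0 0 (\<lambda>j. w j *\<^sub>R apply_bcontfun g j) (int n)"
        by (simp add: mult.commute flip: solution_zero_scaleR)
      have "norm (solution L 0 0 (\<lambda>j. w j *\<^sub>R apply_bcontfun g j) (int n)) \<le>
        c * (\<Sum>j<n. norm (w j *\<^sub>R apply_bcontfun g j))" by (rule c)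
      also have "\<dots> \<le> c * (\<Sum>j<n. \<bar>w j\<bar> * norm g)"
        by (intro mult_left_mono sum_mono c) (simp add: mult_left_mono norm_bounded)
      finally show "norm (solution L 0 0 (\<lambda>j. w j *\<^sub>R apply_bcontfun g j) (int n)) \<le>
        norm g * (c * (\<Sum>j<n. \<bar>w j\<bar>))"
        by (simp add: mult_ac flip: sum_distrib_left)
    qed
  qed
qed (use that in blast)

text \<open>This is the weighted estimate for the constant weight 1.\<close>

lemma bounded_input_bound:
  assumes "ell_stable \<infinity> \<infinity> L"
  obtains C where "0 \<le> C" "\<And>f b n. (\<And>j. norm (f j) \<le> b) \<Longrightarrow>
    norm (solution L 0 0 f (int n)) \<le> C * b"
proof -
  have "bounded (range (\<lambda>n. solution L 0 0 (\<lambda>j. 1 *\<^sub>R apply_bcontfun g j) (int n)))" for g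
    using assms apply_bcontfun[of g] by (auto simp: ell_stable_def ell_def bcontfun_nat_iff)
  then obtain C where C: "0 \<le> C"
    "\<And>g n. norm (solution L 0 0 (\<lambda>j. 1 *\<^sub>R apply_bcontfun g j) (int n)) \<le> C * norm g"
    by (rule weighted_input_bound) blast
  have "norm (solution L 0 0 f (int n)) \<le> C * b" if b: "\<And>j. norm (f j) \<le> b" for f b n
  proof -
    have "f \<in> bcontfun" unfolding bcontfun_nat_iff using b by (auto simp: bounded_iff)
    then have f: "apply_bcontfun (Bcontfun f) = f" by (rule Bcontfun_inverse)
    have "norm (Bcontfun f) \<le> b" by (rule norm_bound) (simp add: f b)
    then show ?thesis using C(2)[of "Bcontfun f" n] C(1)
      by (simp add: f) (meson mult_left_mono order_trans)
  qed
  then show thesis using that C(1) by blast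
qed

text \<open>Varying the summable weight bounds all impulse responses by one constant. Up to time
  \<open>n\<close> an arbitrary input acts as a finite sum of impulses, by causality.\<close>

lemma summable_input_bound:
  fixes L :: "nat \<Rightarrow> 'a::banach hist \<Rightarrow>\<^sub>L 'a"
  assumes stable: "ell_stable 1 \<infinity> L"
  obtains C where "0 \<le> C"
    "\<And>f n. norm (solution L 0 0 f (int n)) \<le> C * (\<Sum>j<n. norm (f j))"
proof -
  define \<delta> :: "nat \<Rightarrow> 'a \<Rightarrow> nat \<Rightarrow> 'a" where "\<delta> k u j = (if j = k then u else 0)" for k u j
  have \<delta>_bcontfun: "\<delta> k u \<in> bcontfun" for k u
    unfolding bcontfun_nat_iff by (rule boundedI[of _ "norm u"]) (auto simp: \<delta>_def)
  have "\<exists>C. \<forall>k. \<forall>u n. norm (solution L 0 0 (\<delta> k u) (int n)) \<le> C * norm u"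
  proof (rule uniform_bound_if_summable_weights)
    fix k c d
    assume "\<forall>u n. norm (solution L 0 0 (\<delta> k u) (int n)) \<le> c * norm u" "c \<le> d"
    then show "\<forall>u n. norm (solution L 0 0 (\<delta> k u) (int n)) \<le> d * norm u"
      by (meson mult_right_mono norm_ge_zero order_trans)
  next
    fix w :: "nat \<Rightarrow> real"
    assume w: "summable w" "\<And>k. 0 \<le> w k"
    have "bounded (range (\<lambda>n. solution L 0 0 (\<lambda>j. w j *\<^sub>R apply_bcontfun g j) (int n)))" for g
    proof -
      have "summable (\<lambda>j. norm (w j *\<^sub>R apply_bcontfun g j))"
      proof (rule summable_comparison_test')
        show "summable (\<lambda>j. w j * norm g)" using w(1) by (rule summable_mult2)
        show "norm (norm (w j *\<^sub>R apply_bcontfun g j)) \<le> w j * norm g" for j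
          using w(2) by (simp add: mult_left_mono norm_bounded)
      qed
      then show ?thesis using stable by (auto simp: ell_stable_def ell_def)
    qed
    then obtain C where C: "0 \<le> C"
      "\<And>g n. norm (solution L 0 0 (\<lambda>j. w j *\<^sub>R apply_bcontfun g j) (int n)) \<le> C * norm g"
      by (rule weighted_input_bound) blast
    have "norm (solution L 0 0 (\<delta> k u) (int n)) \<le> C / w k * norm u" if "w k > 0" for k u n
    proof -
      \<comment> \<open>On an impulse at \<open>k\<close> the weight acts as the scalar
        \<open>w k\<close>, which linearity moves out of the response.\<close>
      have "(\<lambda>j. w j *\<^sub>R \<delta> k u j) = (\<lambda>j. w k *\<^sub>R \<delta> k u j)" by (auto simp: \<delta>_def)
      then have "w k * norm (solution L 0 0 (\<delta> k u) (int n)) =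
        norm (solution L 0 0 (\<lambda>j. w j *\<^sub>R apply_bcontfun (Bcontfun (\<delta> k u)) j) (int n))"
        using w(2) by (simp add: Bcontfun_inverse[OF \<delta>_bcontfun] solution_zero_scaleR)
      also have "\<dots> \<le> C * norm (Bcontfun (\<delta> k u))" by (rule C)
      also have "\<dots> \<le> C * norm u"
        by (intro mult_left_mono C norm_bound) (auto simp: Bcontfun_inverse[OF \<delta>_bcontfun] \<delta>_def)
      finally show ?thesis using that by (simp add: field_simps)
    qed
    then show "\<exists>C. \<forall>k. w k > 0 \<longrightarrow>
      (\<forall>u n. norm (solution L 0 0 (\<delta> k u) (int n)) \<le> C / w k * norm u)" by blast
  qed
  then obtain C where C: "\<And>k u n. norm (solution L 0 0 (\<delta> k u) (int n)) \<le> C * norm u" by blast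
  \<comment> \<open>The truncation index \<open>N\<close> is independent of the time
    \<open>n\<close>, so that impulses can be added one by one at a fixed time.\<close>
  have cut: "norm (solution L 0 0 (\<lambda>j. if j < N then f j else 0) (int n)) \<le> C * (\<Sum>j<N. norm (f j))"
    for f N n
  proof (induction N)
    case 0
    \<comment> \<open>The zero input is the impulse of height 0, hence its response is 0 by the
      impulse bound.\<close>
    have "\<delta> 0 0 = (\<lambda>j. 0)" by (auto simp: \<delta>_def)
    then show ?case using C[of 0 0 n] by simp
  next
    case (Suc N)
    have "(\<lambda>j. if j < Suc N then f j else 0) = (\<lambda>j. (if j < N then f j else 0) + \<delta> N (f N) j)"
      by (auto simp: \<delta>_def less_Suc_eq)
    then have "norm (solution L 0 0 (\<lambda>j. if j < Suc N then f j else 0) (int n)) \<le>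
      norm (solution L 0 0 (\<lambda>j. if j < N then f j else 0) (int n)) +
      norm (solution L 0 0 (\<delta> N (f N)) (int n))"
      by (simp add: solution_zero_add norm_triangle_ineq)
    also have "\<dots> \<le> C * (\<Sum>j<N. norm (f j)) + C * norm (f N)" by (intro add_mono Suc C)
    finally show ?case by (simp add: distrib_left)
  qed
  \<comment> \<open>\<open>C\<close> was obtained without a sign.\<close>
  have "norm (solution L 0 0 f (int n)) \<le> max C 0 * (\<Sum>j<n. norm (f j))" for f n
  proof -
    have "norm (solution L 0 0 f (int n)) =
      norm (solution L 0 0 (\<lambda>j. if j < n then f j else 0) (int n))"
      by (intro arg_cong[of _ _ norm] solution_causal) simp
    also have "\<dots> \<le> C * (\<Sum>j<n. norm (f j))" by (rule cut)
    also have "\<dots> \<le> max C 0 * (\<Sum>j<n. norm (f j))" by (intro mult_right_mono sum_nonneg) auto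
    finally show ?thesis .
  qed
  then show thesis using that by (meson max.cobounded2)
qed

section \<open>Uniform bound on the coefficients\<close>

text \<open>The coordinate of \<open>\<psi>\<close> at \<open>M\<close> is produced by an impulse at time \<open>n - M - 1\<close>; the prehistory of its
  response at time \<open>n\<close> differs from \<open>\<psi>\<close> only in coordinates below \<open>M\<close>.\<close>

lemma recent_coords_bound:
  fixes L :: "nat \<Rightarrow> 'a::banach hist \<Rightarrow>\<^sub>L 'a"
  assumes C: "0 \<le> C"
    "\<And>k u n. norm (solution L 0 0 (\<lambda>j. if j = k then u else 0) (int n)) \<le> C * norm u"
  shows "\<exists>B\<ge>0. \<forall>n \<psi>. (\<forall>k\<ge>M. apply_bcontfun \<psi> k = 0) \<longrightarrow>
    norm (blinfun_apply (L n) \<psi>) \<le> B * norm \<psi>"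
proof (induction M)
  case 0
  have "blinfun_apply (L n) \<psi> = 0" if "\<forall>k\<ge>0. apply_bcontfun \<psi> k = 0" for n \<psi>
  proof -
    have "\<psi> = 0" using that by (intro bcontfun_eqI) simp
    then show ?thesis by simp
  qed
  then show ?case by (intro exI[of _ 0]) auto
next
  case (Suc M)
  then obtain B where B: "0 \<le> B"
    "\<And>n \<psi>. (\<And>k. k \<ge> M \<Longrightarrow> apply_bcontfun \<psi> k = 0) \<Longrightarrow>
       norm (blinfun_apply (L n) \<psi>) \<le> B * norm \<psi>" by blast
  \<comment> \<open>The sum covers the times \<open>n \<le> M\<close>, for which
    \<open>n - M - 1\<close> is negative and no impulse can be placed; the rest is the estimate for
    later \<open>n\<close>.\<close>
  define D where "D = C + B * (C + 1) + (\<Sum>n\<le>M. norm (L n))"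
  have D: "C + B * (C + 1) \<le> D" "0 \<le> D" using B(1) C(1) by (auto simp: D_def sum_nonneg)
  have "norm (blinfun_apply (L n) \<psi>) \<le> D * norm \<psi>"
    if \<psi>: "\<And>k. k \<ge> Suc M \<Longrightarrow> apply_bcontfun \<psi> k = 0" for n \<psi>
  proof (cases "n \<le> M")
    case True
    have "norm (L n) \<le> (\<Sum>n\<le>M. norm (L n))" using True by (intro member_le_sum) auto
    then have "norm (L n) \<le> D" using B(1) C(1) by (simp add: D_def add_increasing)
    then show ?thesis using norm_blinfun[of "L n" \<psi>]
      by (meson mult_right_mono norm_ge_zero order_trans)
  next
    case False
    define u where "u = apply_bcontfun \<psi> M"
    define k where "k = n - Suc M"
    define f where "f j = (if j = k then u else 0)" for j
    define x where "x = solution L 0 0 f"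
    have n: "n = Suc M + k" using False by (simp add: k_def)
    have x: "is_solution L 0 0 f x" by (simp add: x_def solution_is_solution)
    have u: "norm u \<le> norm \<psi>" by (simp add: u_def norm_bounded)
    have x_bound: "norm (x (int i)) \<le> C * norm \<psi>" for i
      using C(2)[of k u i] mult_left_mono[OF u C(1)] unfolding x_def f_def by linarith
    have x_past: "x i = 0" if "i \<le> int k" for i
    proof (cases "i \<le> 0")
      case True
      then show ?thesis using is_solution_past[OF x] by simp
    next
      case False
      \<comment> \<open>Up to time \<open>k\<close> the impulse has not acted yet: causality
        compares it with the zero input, written as \<open>0 *\<^sub>R f j\<close> to use
        linearity.\<close>
      then have "solution L 0 0 f (int (nat i)) = solution L 0 0 (\<lambda>j. 0 *\<^sub>R f j) (int (nat i))"
        by (intro solution_causal) (use that in \<open>auto simp: f_def\<close>)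
      then have "solution L 0 0 f (int (nat i)) = 0"
        unfolding solution_zero_scaleR by simp
      then show ?thesis using False by (simp add: x_def)
    qed
    have "bprehist x (int k) = 0"
      by (rule bcontfun_eqI) (simp add: apply_bprehist_solution[OF x] x_past)
    then have x_u: "x (int (Suc k)) = u"
      using is_solution_step[OF x, of k] by (simp add: f_def blinfun.zero_right)
    have coord: "apply_bcontfun (bprehist x (int n) - \<psi>) l = x (int n - int l) - apply_bcontfun \<psi> l"
      for l by (simp add: apply_bprehist_solution[OF x])
    have "apply_bcontfun (bprehist x (int n) - \<psi>) l = 0" if "l \<ge> M" for l
    proof (cases "l = M")
      case True
      then have "int n - int l = int (Suc k)" by (simp add: n)
      then show ?thesis unfolding coord using x_u True u_def by simp
    next
      case False
      then show ?thesis unfolding coord using that \<psi>[of l] x_past[of "int n - int l"] by (simp add: n)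
    qed
    then have "norm (blinfun_apply (L n) (bprehist x (int n) - \<psi>)) \<le>
      B * norm (bprehist x (int n) - \<psi>)" by (rule B(2))
    also have "\<dots> \<le> B * (C * norm \<psi> + norm \<psi>)"
    proof (intro mult_left_mono B(1) order_trans[OF norm_triangle_ineq4] add_right_mono)
      show "norm (bprehist x (int n)) \<le> C * norm \<psi>"
        by (rule norm_bprehist_le[OF x]) (use x_bound C in auto)
    qed
    finally have rest: "norm (blinfun_apply (L n) (bprehist x (int n) - \<psi>)) \<le>
      B * (C * norm \<psi> + norm \<psi>)" .
    \<comment> \<open>The impulse at \<open>k < n\<close> is over, so the input at time
      \<open>n\<close> is zero and \<open>x (n + 1)\<close> is \<open>L n\<close> applied to the
      prehistory.\<close>
    have "blinfun_apply (L n) \<psi> =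
      x (int (Suc n)) - blinfun_apply (L n) (bprehist x (int n) - \<psi>)"
      unfolding is_solution_step[OF x le0] by (simp add: blinfun.diff_right f_def n)
    then have "norm (blinfun_apply (L n) \<psi>) \<le> C * norm \<psi> + B * (C * norm \<psi> + norm \<psi>)"
      by (simp only:) (rule order_trans[OF norm_triangle_ineq4 add_mono[OF x_bound rest]])
    also have "\<dots> = (C + B * (C + 1)) * norm \<psi>" by (simp add: algebra_simps)
    also have "\<dots> \<le> D * norm \<psi>" by (intro mult_right_mono D) simp
    finally show ?thesis .
  qed
  then show ?case using D(2) by blast
qed

text \<open>The part of \<open>\<psi>\<close> kept by \<open>past_proj m\<close> is controlled by
  \<open>b\<close>. The remainder \<open>\<psi> - \<xi>\<close> lives on finitely many recent
  coordinates, all below \<open>nat (1 - m)\<close>, where impulse responses control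
  \<open>L n\<close>.\<close>

lemma bounded_coefficients:
  fixes L :: "nat \<Rightarrow> 'a::banach hist \<Rightarrow>\<^sub>L 'a"
  assumes C: "0 \<le> C"
    "\<And>k u n. norm (solution L 0 0 (\<lambda>j. if j = k then u else 0) (int n)) \<le> C * norm u"
    and b: "\<And>n. norm (L n o\<^sub>L past_proj m) \<le> b"
  obtains B where "0 \<le> B" "\<And>n \<psi>. norm (blinfun_apply (L n) \<psi>) \<le> B * norm \<psi>"
proof -
  obtain B where B: "0 \<le> B"
    "\<And>n \<psi>. (\<And>k. k \<ge> nat (1 - m) \<Longrightarrow> apply_bcontfun \<psi> k = 0) \<Longrightarrow>
       norm (blinfun_apply (L n) \<psi>) \<le> B * norm \<psi>"
    using recent_coords_bound[OF C, of "nat (1 - m)"] by metis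
  have "0 \<le> b" using b[of 0] norm_ge_zero order_trans by blast
  have "norm (blinfun_apply (L n) \<psi>) \<le> (b + B) * norm \<psi>" for n \<psi>
  proof -
    define \<xi> where "\<xi> = blinfun_apply (past_proj m) \<psi>"
    have \<xi>: "apply_bcontfun \<xi> k = (if - int k \<le> m then apply_bcontfun \<psi> k else 0)" for k
      by (simp add: \<xi>_def past_proj.rep_eq apply_past_proj_fun)
    have "norm (blinfun_apply (L n) \<xi>) \<le> b * norm \<psi>"
      using norm_blinfun[of "L n o\<^sub>L past_proj m" \<psi>] mult_right_mono[OF b norm_ge_zero, of n \<psi>]
      by (simp add: \<xi>_def)
    moreover have "norm (blinfun_apply (L n) (\<psi> - \<xi>)) \<le> B * norm (\<psi> - \<xi>)"
      by (rule B(2)) (auto simp: \<xi>)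
    moreover have "B * norm (\<psi> - \<xi>) \<le> B * norm \<psi>"
      by (intro mult_left_mono B norm_bound) (simp add: \<xi> norm_bounded)
    moreover have "norm (blinfun_apply (L n) \<psi>) \<le>
      norm (blinfun_apply (L n) \<xi>) + norm (blinfun_apply (L n) (\<psi> - \<xi>))"
      using norm_triangle_ineq[of "blinfun_apply (L n) \<xi>" "blinfun_apply (L n) (\<psi> - \<xi>)"]
      by (simp add: blinfun.diff_right)
    ultimately show ?thesis using B(1) by (simp add: algebra_simps)
  qed
  then show thesis using that \<open>0 \<le> b\<close> B(1) by (metis add_nonneg_nonneg)
qed

section \<open>Reduction to zero initial data\<close>

text \<open>This is what remains of the initial data in the prehistory \<open>d\<close> steps later:
  the newer coordinates are set to zero.\<close>

definition shift_hist :: "nat \<Rightarrow> 'a::real_normed_vector hist \<Rightarrow> 'a hist" where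
  "shift_hist d \<phi> = Bcontfun (\<lambda>k. if d \<le> k then apply_bcontfun \<phi> (k - d) else 0)"

lemma apply_shift_hist:
  "apply_bcontfun (shift_hist d \<phi>) k = (if d \<le> k then apply_bcontfun \<phi> (k - d) else 0)"
proof -
  have "(\<lambda>k. if d \<le> k then apply_bcontfun \<phi> (k - d) else 0) \<in> bcontfun"
    unfolding bcontfun_nat_iff by (rule boundedI[of _ "norm \<phi>"]) (auto simp: norm_bounded)
  then show ?thesis by (simp add: shift_hist_def Bcontfun_inverse)
qed

lemma norm_shift_hist_le: "norm (shift_hist d \<phi>) \<le> norm \<phi>"
  by (rule norm_bound) (simp add: apply_shift_hist norm_bounded)

text \<open>Deleting from a homogeneous solution everything up to time \<open>\<tau>\<close> leaves a solution with zero
  initial data; its input is the effect of the deleted coordinates.\<close>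

definition cut_input :: "(nat \<Rightarrow> 'a::banach hist \<Rightarrow>\<^sub>L 'a) \<Rightarrow> nat \<Rightarrow> 'a hist \<Rightarrow> nat \<Rightarrow> 'a" where
  "cut_input L \<tau> \<phi> n = (if n < \<tau> then 0 else blinfun_apply (L n) (shift_hist (n - \<tau>) \<phi>))"

lemma solution_cut_input:
  assumes "int \<tau> < i"
  shows "solution L 0 0 (cut_input L \<tau> \<phi>) i = solution L \<tau> \<phi> (\<lambda>_. 0) i"
proof -
  define x where "x = solution L \<tau> \<phi> (\<lambda>_. 0)"
  have x: "is_solution L \<tau> \<phi> (\<lambda>_. 0) x" by (simp add: x_def solution_is_solution)
  define y where "y i = (if i \<le> int \<tau> then 0 else x i)" for i
  have "is_solution L 0 0 (cut_input L \<tau> \<phi>) y"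
    unfolding is_solution_def
  proof (intro conjI allI impI)
    show "prehist y (int 0) = apply_bcontfun 0" by (auto simp: prehist_def y_def)
    fix n
    show "y (int n + 1) = blinfun_apply (L n) (bprehist y (int n)) + cut_input L \<tau> \<phi> n"
    proof (cases "n < \<tau>")
      case True
      then have "prehist y (int n) = apply_bcontfun 0" by (auto simp: prehist_def y_def)
      then have "bprehist y (int n) = 0" by (metis apply_bcontfun_inverse bprehist_def)
      then show ?thesis using True by (simp add: y_def cut_input_def blinfun.zero_right)
    next
      case False
      then have n: "\<tau> \<le> n" by simp
      have "prehist y (int n) = apply_bcontfun (bprehist x (int n) - shift_hist (n - \<tau>) \<phi>)"
      proof
        fix k
        show "prehist y (int n) k =
          apply_bcontfun (bprehist x (int n) - shift_hist (n - \<tau>) \<phi>) k"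
        \<comment> \<open>The condition says \<open>n - k \<le> \<tau>\<close>; the value at time
          \<open>\<tau>\<close> itself is among the deleted ones.\<close>
        proof (cases "n - \<tau> \<le> k")
          case True
          then have i: "int n - int k \<le> int \<tau>" "nat (int \<tau> - (int n - int k)) = k - (n - \<tau>)"
            using n by auto
          show ?thesis
            using True is_solution_past[OF x i(1)] i
            by (simp add: prehist_def y_def apply_bprehist_solution[OF x n] apply_shift_hist)
        next
          case False
          then show ?thesis
            by (auto simp: prehist_def y_def apply_bprehist_solution[OF x n] apply_shift_hist)
        qed
      qed
      then have "bprehist y (int n) = bprehist x (int n) - shift_hist (n - \<tau>) \<phi>"
        by (metis apply_bcontfun_inverse bprehist_def)
      then show ?thesis
        using n is_solution_step[OF x n]
        by (simp add: y_def cut_input_def blinfun.diff_right add.commute)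
    qed
  qed
  then show ?thesis using assms by (simp add: solution_eqI y_def x_def)
qed

text \<open>A prehistory at \<open>n\<close> consists of coordinates of \<open>\<phi>\<close>, which
  need the constant 1, and of values after \<open>\<tau>\<close>, which agree with the cut solution
  and need \<open>K\<close>.\<close>

lemma uniformly_stable_if_cut_bound:
  assumes "\<And>\<tau> \<phi> n. norm (solution L 0 0 (cut_input L \<tau> \<phi>) (int n)) \<le> K * norm \<phi>"
  shows "uniformly_stable L"
  unfolding uniformly_stable_def
proof (intro exI[of _ "max 1 K"] conjI allI impI)
  fix \<tau> n :: nat and \<phi> :: "'a hist"
  assume "\<tau> \<le> n"
  have K: "1 * norm \<phi> \<le> max 1 K * norm \<phi>" "K * norm \<phi> \<le> max 1 K * norm \<phi>"
    by (intro mult_right_mono; simp)+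
  show "norm (bprehist (solution L \<tau> \<phi> (\<lambda>_. 0)) (int n)) \<le> max 1 K * norm \<phi>"
  proof (rule norm_bprehist_le[OF solution_is_solution \<open>\<tau> \<le> n\<close>])
    fix i assume "\<tau> < i"
    then show "norm (solution L \<tau> \<phi> (\<lambda>_. 0) (int i)) \<le> max 1 K * norm \<phi>"
      using solution_cut_input[of \<tau> "int i" L \<phi>] assms[of \<tau> \<phi> i] K(2) by simp
  qed (use K in simp)
qed simp

section \<open>The two stability criteria\<close>

text \<open>Uniformly bounded coefficients make the cut input bounded by
  \<open>B * norm \<phi>\<close>, whatever \<open>\<tau>\<close> is.\<close>

lemma uniformly_stable_bounded_input:
  assumes "ell_stable \<infinity> \<infinity> L" and m: "bdd_above (range (\<lambda>n. norm (L n o\<^sub>L past_proj m)))"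
  shows "uniformly_stable L"
proof -
  obtain C where C: "0 \<le> C"
    "\<And>f b n. (\<And>j. norm (f j) \<le> b) \<Longrightarrow> norm (solution L 0 0 f (int n)) \<le> C * b"
    using bounded_input_bound[OF assms(1)] by blast
  obtain b where b: "\<And>n. norm (L n o\<^sub>L past_proj m) \<le> b" using m by (auto simp: bdd_above_def)
  have impulse: "norm (solution L 0 0 (\<lambda>j. if j = k then u else 0) (int n)) \<le> C * norm u" for k u n
    by (rule C(2)) simp
  obtain B where B: "0 \<le> B" "\<And>n \<psi>. norm (blinfun_apply (L n) \<psi>) \<le> B * norm \<psi>"
    using bounded_coefficients[OF C(1) impulse b] by blast
  have "norm (cut_input L \<tau> \<phi> n) \<le> B * norm \<phi>" for \<tau> \<phi> n
    unfolding cut_input_def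
    using order_trans[OF B(2) mult_left_mono[OF norm_shift_hist_le B(1)]] B(1) by simp
  then have "norm (solution L 0 0 (cut_input L \<tau> \<phi>) (int n)) \<le> C * B * norm \<phi>" for \<tau> \<phi> n
    using C(2)[of "cut_input L \<tau> \<phi>" "B * norm \<phi>" n] by (simp add: mult.assoc)
  then show ?thesis by (rule uniformly_stable_if_cut_bound)
qed

text \<open>The cut input has at most \<open>M\<close> values that need the coefficient bound
  \<open>B\<close>; the later ones are dominated by the summable norms. Its sum is therefore bounded
  independently of \<open>\<tau>\<close>.\<close>

lemma uniformly_stable_summable_input:
  assumes "ell_stable 1 \<infinity> L" and m: "summable (\<lambda>n. norm (L n o\<^sub>L past_proj m))"
  shows "uniformly_stable L"
proof -
  obtain C where C: "0 \<le> C"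
    "\<And>f n. norm (solution L 0 0 f (int n)) \<le> C * (\<Sum>j<n. norm (f j))"
    using summable_input_bound[OF assms(1)] by blast
  define s where "s = (\<Sum>n. norm (L n o\<^sub>L past_proj m))"
  have s: "(\<Sum>j\<in>J. norm (L j o\<^sub>L past_proj m)) \<le> s" if "finite J" for J
    unfolding s_def by (rule sum_le_suminf[OF m that]) simp
  have b: "norm (L n o\<^sub>L past_proj m) \<le> s" for n using s[of "{n}"] by simp
  have impulse: "norm (solution L 0 0 (\<lambda>j. if j = k then u else 0) (int n)) \<le> C * norm u" for k u n
  proof -
    have "(\<Sum>j<n. norm (if j = k then u else 0)) = (\<Sum>j<n. if j = k then norm u else 0)"
      by (intro sum.cong) auto
    also have "\<dots> \<le> norm u" by (simp add: sum.delta)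
    finally show ?thesis using C(2)[of "\<lambda>j. if j = k then u else 0" n] C(1)
      by (meson mult_left_mono order_trans)
  qed
  obtain B where B: "0 \<le> B" "\<And>n \<psi>. norm (blinfun_apply (L n) \<psi>) \<le> B * norm \<psi>"
    using bounded_coefficients[OF C(1) impulse b] by blast
  \<comment> \<open>From time \<open>\<tau> + M\<close> on, the shifted \<open>\<phi>\<close> has
    only coordinates with index at most \<open>m\<close>, so \<open>past_proj m\<close> fixes
    it.\<close>
  define M where "M = nat (- m)"
  have "norm (solution L 0 0 (cut_input L \<tau> \<phi>) (int n)) \<le> C * (s + M * B) * norm \<phi>" for \<tau> \<phi> n
  proof -
    define r where "r j = (if j \<in> {\<tau>..<\<tau> + M} then B else 0)" for j
    have r: "0 \<le> r j" for j using B(1) by (simp add: r_def)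
    have "norm (cut_input L \<tau> \<phi> j) \<le> (norm (L j o\<^sub>L past_proj m) + r j) * norm \<phi>" for j
    proof (cases "j < \<tau> + M")
      case True
      then have "norm (cut_input L \<tau> \<phi> j) \<le> r j * norm \<phi>"
        using B(2)[of j "shift_hist (j - \<tau>) \<phi>"]
          mult_left_mono[OF norm_shift_hist_le[of "j - \<tau>" \<phi>] B(1)]
        by (auto simp: cut_input_def r_def)
      then show ?thesis by (simp add: distrib_right add_increasing)
    next
      case False
      have "blinfun_apply (past_proj m) (shift_hist (j - \<tau>) \<phi>) = shift_hist (j - \<tau>) \<phi>"
        by (rule bcontfun_eqI)
          (use False in \<open>auto simp: past_proj.rep_eq apply_past_proj_fun apply_shift_hist M_def\<close>)
      then have "norm (cut_input L \<tau> \<phi> j) =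
        norm (blinfun_apply (L j o\<^sub>L past_proj m) (shift_hist (j - \<tau>) \<phi>))"
        using False by (simp add: cut_input_def)
      also have "\<dots> \<le> norm (L j o\<^sub>L past_proj m) * norm \<phi>"
        by (intro order_trans[OF norm_blinfun] mult_left_mono norm_shift_hist_le) simp
      also have "\<dots> \<le> (norm (L j o\<^sub>L past_proj m) + r j) * norm \<phi>"
        by (intro mult_right_mono) (simp_all add: r)
      finally show ?thesis .
    qed
    then have "(\<Sum>j<n. norm (cut_input L \<tau> \<phi> j)) \<le>
      (\<Sum>j<n. (norm (L j o\<^sub>L past_proj m) + r j) * norm \<phi>)" by (intro sum_mono)
    also have "\<dots> = ((\<Sum>j<n. norm (L j o\<^sub>L past_proj m)) + (\<Sum>j<n. r j)) * norm \<phi>"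
      by (simp add: sum.distrib flip: sum_distrib_right)
    also have "\<dots> \<le> (s + M * B) * norm \<phi>"
    proof (intro mult_right_mono add_mono s)
      \<comment> \<open>Enlarging the index set to contain the whole window gives a bound free of
        \<open>n\<close> and \<open>\<tau>\<close>.\<close>
      have "(\<Sum>j<n. r j) \<le> (\<Sum>j\<in>{..<n} \<union> {\<tau>..<\<tau> + M}. r j)" by (rule sum_mono2) (auto simp: r)
      also have "\<dots> = (\<Sum>j\<in>{\<tau>..<\<tau> + M}. r j)" by (rule sum.mono_neutral_right) (auto simp: r_def)
      also have "\<dots> = M * B" by (simp add: r_def)
      finally show "(\<Sum>j<n. r j) \<le> M * B" .
    qed auto
    finally have "C * (\<Sum>j<n. norm (cut_input L \<tau> \<phi> j)) \<le> C * ((s + M * B) * norm \<phi>)"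
      using C(1) by (intro mult_left_mono)
    then show ?thesis using C(2)[of "cut_input L \<tau> \<phi>" n] by (simp add: mult.assoc)
  qed
  then show ?thesis by (rule uniformly_stable_if_cut_bound)
qed

theorem corollary4p9:
  fixes L :: "nat \<Rightarrow> 'a::banach hist \<Rightarrow>\<^sub>L 'a"
  shows "(ell_stable \<infinity> \<infinity> L \<and>
            (\<exists>m::int. m \<le> 0 \<and> bdd_above (range (\<lambda>n. norm (L n o\<^sub>L past_proj m))))
          \<longrightarrow> uniformly_stable L)
       \<and> (ell_stable 1 \<infinity> L \<and>
            (\<exists>m::int. m \<le> 0 \<and> summable (\<lambda>n. norm (L n o\<^sub>L past_proj m)))
          \<longrightarrow> uniformly_stable L)"
  by (auto intro: uniformly_stable_bounded_input uniformly_stable_summable_input)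

end
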